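(* Let $\lambda_0\in\mathbb{N}$, $\nu\in\mathbb{N}\setminus\{0\}$ and $\lambda_k=\lambda_0+k\nu$ for $k\ge 0$. Let $\mathcal{L}^+(\hat\lambda,\nu)$ be the loss function of this restart strategy, and let $$\mathcal{L}^+_{\mathrm{low}}(\hat\lambda,\nu)=\frac12\left(\hat\lambda-\lambda_0\right)\left(\frac{\hat\lambda+\lambda_0}{\nu}-1\right).$$ Then $\mathcal{L}^+_{\mathrm{low}}(\hat\lambda,\nu)$ is a lower bound of $\mathcal{L}^+(\hat\lambda,\nu)$, i.e. $\mathcal{L}^+(\hat\lambda,\nu)\ge\mathcal{L}^+_{\mathrm{low}}(\hat\lambda,\nu)$ for all integers $\hat\lambda\ge\lambda_0$.
   Context: For a restart strategy $(\lambda_0,\lambda_1,\lambda_2,\ldots)$ (an unbounded sequence of natural numbers) and an integer $\hat\lambda\ge\lambda_0$, let $\hat k(\hat\lambda)=\min\{k\ge 0:\lambda_k\ge\hat\lambda\}$. The loss function is $\mathcal{L}(\hat\lambda)=\sum_{k=0}^{\hat k(\hat\lambda)}\lambda_k-\hat\lambda$; it is denoted $\mathcal{L}^+(\hat\lambda,\nu)$ for the additive strategy $\lambda_k=\lambda_0+k\nu$. *)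

theory Defs
  imports Complex_Main
begin

definition restart_strategy :: "(nat \<Rightarrow> nat) \<Rightarrow> bool" where
  "restart_strategy lam \<longleftrightarrow> (\<forall>B. \<exists>k. lam k > B)"

(* The set below is nonempty whenever lam is a restart strategy, so the LEAST is a true minimum. *)
definition khat :: "(nat \<Rightarrow> nat) \<Rightarrow> int \<Rightarrow> nat" where
  "khat lam lhat = (LEAST k. int (lam k) \<ge> lhat)"

(* Integer-valued, so that the subtraction does not truncate. *)
definition loss :: "(nat \<Rightarrow> nat) \<Rightarrow> int \<Rightarrow> int" where
  "loss lam lhat = (\<Sum>k = 0..khat lam lhat. int (lam k)) - lhat"

definition additive_strategy :: "nat \<Rightarrow> nat \<Rightarrow> nat \<Rightarrow> nat" where
  "additive_strategy lam0 \<nu> k = lam0 + k * \<nu>"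

definition loss_add :: "nat \<Rightarrow> int \<Rightarrow> nat \<Rightarrow> int" where
  "loss_add lam0 lhat \<nu> = loss (additive_strategy lam0 \<nu>) lhat"

definition loss_add_low :: "nat \<Rightarrow> int \<Rightarrow> nat \<Rightarrow> real" where
  "loss_add_low lam0 lhat \<nu> =
     1 / 2 * (real_of_int lhat - real lam0) * ((real_of_int lhat + real lam0) / real \<nu> - 1)"

lemma restart_strategy_additive:
  assumes "\<nu> > 0"
  shows "restart_strategy (additive_strategy lam0 \<nu>)"
  unfolding restart_strategy_def
proof
  fix B
  have "B < Suc B * 1" by simp
  also have "\<dots> \<le> Suc B * \<nu>"
    using assms by (intro mult_le_mono2) simp
  finally have "additive_strategy lam0 \<nu> (Suc B) > B"
    unfolding additive_strategy_def by (rule trans_less_add2)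
  then show "\<exists>k. additive_strategy lam0 \<nu> k > B" ..
qed

lemma khat_reaches:
  assumes "restart_strategy lam"
  shows "int (lam (khat lam lhat)) \<ge> lhat"
proof -
  obtain k where "lam k > nat lhat"
    using assms unfolding restart_strategy_def by blast
  then have "int (lam k) \<ge> lhat" by linarith
  then show ?thesis unfolding khat_def by (rule LeastI)
qed

end

theory Submission
  imports Defs
begin

text \<open>Put \<open>t = (\<lambda> - \<lambda>\<^sub>0) / \<nu>\<close> with \<open>\<lambda>\<close> the target value, and let \<open>K\<close> be the number of restarts. The loss exceeds
  the bound by \<open>\<lambda>\<^sub>0 (K - t) + \<nu>/2 (K (K + 1) - t (t + 1))\<close>, and \<open>0 \<le> t \<le> K\<close>.\<close>

text \<open>Number of terms times the mean of the first and the last; over the reals the halving is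
  exact.\<close>

lemma sum_additive_strategy:
  "(\<Sum>k = 0..n. real (additive_strategy a d k)) = (real n + 1) * (real a + real d * real n / 2)"
  by (induction n) (simp_all add: additive_strategy_def field_simps)

theorem theorem2:
  fixes lam0 \<nu> :: nat
  assumes "\<nu> \<noteq> 0"
  shows "\<forall>lhat::int. lhat \<ge> int lam0 \<longrightarrow>
           real_of_int (loss_add lam0 lhat \<nu>) \<ge> loss_add_low lam0 lhat \<nu>"
proof (intro allI impI)
  fix lhat :: int
  assume ge: "lhat \<ge> int lam0"
  define K where "K = khat (additive_strategy lam0 \<nu>) lhat"
  define t where "t = (real_of_int lhat - real lam0) / real \<nu>"
  have lhat: "real_of_int lhat = real lam0 + t * real \<nu>"
    using assms by (simp add: t_def)
  have t0: "t \<ge> 0"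
    using ge by (simp add: t_def)
  \<comment> \<open>As \<open>\<nu>\<close> is positive, the strategy is unbounded, so its value at
    index \<open>K\<close> does reach the target.\<close>
  have "lhat \<le> int (lam0 + K * \<nu>)"
    using khat_reaches[OF restart_strategy_additive, of \<nu> lhat lam0] assms
    by (simp add: K_def additive_strategy_def)
  then have "real_of_int lhat \<le> real lam0 + real K * real \<nu>"
    by (metis of_int_le_iff of_int_of_nat_eq of_nat_add of_nat_mult)
  then have tK: "t \<le> real K"
    using assms by (simp add: lhat)
  have loss: "real_of_int (loss_add lam0 lhat \<nu>)
      = (real K + 1) * (real lam0 + real \<nu> * real K / 2) - (real lam0 + t * real \<nu>)"
    by (simp add: loss_add_def loss_def sum_additive_strategy lhat flip: K_def)
  \<comment> \<open>The factor \<open>\<nu>\<close> of \<open>lhat - lam0 = t * \<nu>\<close> clears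
    the denominator in the second factor.\<close>
  have low: "loss_add_low lam0 lhat \<nu> = t / 2 * (2 * real lam0 + t * real \<nu> - real \<nu>)"
    using assms by (simp add: loss_add_low_def lhat field_simps)
  \<comment> \<open>Loss and bound are \<open>lam0 * x + \<nu> / 2 * x * (x + 1) - t * \<nu>\<close>
    at \<open>x = K\<close> and \<open>x = t\<close>; the last term cancels.\<close>
  have "real_of_int (loss_add lam0 lhat \<nu>) - loss_add_low lam0 lhat \<nu>
      = real lam0 * (real K - t) + real \<nu> / 2 * (real K * (real K + 1) - t * (t + 1))"
    unfolding loss low by (simp add: field_simps)
  moreover have "t * (t + 1) \<le> real K * (real K + 1)"
    using t0 tK by (intro mult_mono) auto
  ultimately show "real_of_int (loss_add lam0 lhat \<nu>) \<ge> loss_add_low lam0 lhat \<nu>"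
    using tK by (smt (verit) divide_nonneg_nonneg mult_nonneg_nonneg of_nat_0_le_iff)
qed

end
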